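(* Let $t$ be a positive integer and let $\tau:\mathbb{Z}\to F$ be any function from $\mathbb{Z}$ to a field $F$. Then there is a bijection $\phi_t:\lambda\mapsto \vec V=(v_0,v_1,\ldots,v_{t-1})$ from the set of $t$-core partitions onto the set of $V_t$-codings such that for every $t$-core $\lambda$, with $\vec V=\phi_t(\lambda)$, $$|\lambda|=\frac{1}{2t}\left(v_0^2+v_1^2+\cdots+v_{t-1}^2\right)-\frac{t^2-1}{24},$$ and, whenever all denominators below are nonzero (i.e. $\tau(h)\neq 0$ for all $h\in\mathcal{H}(\lambda)$ and $\tau(i)\ne 0$ for $1\le i\le t-1$), $$\prod_{h\in\mathcal{H}(\lambda)}\frac{\tau(h-t)\,\tau(h+t)}{\tau(h)^2}=\prod_{i=1}^{t-1}\frac{\tau(-i)^{\beta_i(\lambda)}}{\tau(i)^{\beta_i(\lambda)+t-i}}\;\prod_{0\le i<j\le t-1}\tau(v_i-v_j),$$ where $\beta_i(\lambda)=\#\{\square\in\lambda: h(\square)=t-i\}$ is the number of boxes of $\lambda$ with hook length $t-i$.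
   Context: Partitions are integer partitions (including the empty one); $|\lambda|$ is the size of $\lambda$, $h(\square)$ is the hook length of a box $\square$ in the Ferrers diagram of $\lambda$, and $\mathcal{H}(\lambda)$ is the multiset of all hook lengths of $\lambda$. A partition is a $t$-core if none of its hook lengths is divisible by $t$. Put $t_0=0$ if $t$ is odd and $t_0=1/2$ if $t$ is even, and $\mathbb{Z}'=t_0+\mathbb{Z}$. A vector $\vec V=(v_0,\ldots,v_{t-1})\in(\mathbb{Z}')^t$ is called a $V_t$-coding if: (i) the classes modulo $t$ of $v_0,\ldots,v_{t-1}$ are exactly the classes modulo $t$ of the elements of $t_0+\{0,1,\ldots,t-1\}$ (each occurring once); (ii) $v_0+v_1+\cdots+v_{t-1}=0$; (iii) $v_0>v_1>\cdots>v_{t-1}$. *)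

theory Defs
  imports Complex_Main "HOL-Library.Multiset" "HOL-Library.Real_Mod"
begin

text \<open>
  An integer partition is the weakly decreasing list of its positive parts; its size is
  \<^term>\<open>sum_list\<close>.
\<close>

definition is_partition :: "nat list \<Rightarrow> bool" where
  "is_partition l \<longleftrightarrow> sorted_wrt (\<ge>) l \<and> (\<forall>x \<in> set l. x > 0)"

definition boxes :: "nat list \<Rightarrow> (nat \<times> nat) set" where
  "boxes l = {(i, j). i < length l \<and> j < l ! i}"

text \<open>
  The hook of a box consists of the box itself, the boxes to its right in the same row and
  the boxes below it in the same column.
\<close>

definition hook :: "nat list \<Rightarrow> nat \<times> nat \<Rightarrow> (nat \<times> nat) set" where
  "hook l b = {(i, j) \<in> boxes l. i = fst b \<and> j \<ge> snd b \<or> j = snd b \<and> i \<ge> fst b}"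

definition hook_length :: "nat list \<Rightarrow> nat \<times> nat \<Rightarrow> nat" where
  "hook_length l b = card (hook l b)"

definition hook_mset :: "nat list \<Rightarrow> nat multiset" where
  "hook_mset l = image_mset (hook_length l) (mset_set (boxes l))"

definition is_core :: "nat \<Rightarrow> nat list \<Rightarrow> bool" where
  "is_core t l \<longleftrightarrow> is_partition l \<and> (\<forall>h \<in># hook_mset l. \<not> t dvd h)"

definition hook_count :: "nat list \<Rightarrow> nat \<Rightarrow> nat" where
  "hook_count l k = card {b \<in> boxes l. hook_length l b = k}"

definition t_zero :: "nat \<Rightarrow> real" where
  "t_zero t = (if odd t then 0 else 1 / 2)"

definition Z_prime :: "nat \<Rightarrow> real set" where
  "Z_prime t = range (\<lambda>k::int. t_zero t + of_int k)"

text \<open>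
  Vectors are lists of length \<open>t\<close>. A residue class modulo \<open>t\<close> is represented by its canonical
  representative \<^term>\<open>x rmod t\<close>; the bijection says that every class of an element of
  \<open>t_zero t + {0, ..., t - 1}\<close> is the class of exactly one entry and no other class occurs.
\<close>

definition V_coding :: "nat \<Rightarrow> real list \<Rightarrow> bool" where
  "V_coding t V \<longleftrightarrow>
     length V = t \<and> set V \<subseteq> Z_prime t \<and>
     bij_betw (\<lambda>i. (V ! i) rmod real t) {..<t}
       ((\<lambda>k. (t_zero t + real k) rmod real t) ` {0..<t}) \<and>
     sum_list V = 0 \<and>
     (\<forall>i j. i < j \<longrightarrow> j < t \<longrightarrow> V ! i > V ! j)"

text \<open>
  Differences of entries are integers, so applying \<^term>\<open>floor\<close> to them is a mere type
  conversion to \<^typ>\<open>int\<close>.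
\<close>

lemma V_coding_diff_int:
  assumes "V_coding t V" "i < t" "j < t"
  shows "of_int \<lfloor>V ! i - V ! j\<rfloor> = V ! i - V ! j"
proof -
  have "V ! i \<in> Z_prime t" "V ! j \<in> Z_prime t"
    using assms by (auto simp: V_coding_def)
  then obtain m n :: int where "V ! i = t_zero t + of_int m" "V ! j = t_zero t + of_int n"
    by (auto simp: Z_prime_def)
  then have "V ! i - V ! j = of_int (m - n)"
    by simp
  then show ?thesis
    by (metis floor_of_int)
qed

end

theory Submission
  imports Defs
begin

text \<open>
  Encode a partition \<open>l\<close> by the set \<open>X = {l_i - i - 1}\<close> of integers. Boxes with hook length
  \<open>k > 0\<close> correspond to elements \<open>x \<in> X\<close> with \<open>x - k \<notin> X\<close>; let \<open>M k\<close> be the number of the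
  latter, for any integer \<open>k\<close>. Then \<open>M (-k) = M k + k\<close> for \<open>k \<ge> 0\<close>. The partition is a
  \<open>t\<close>-core iff \<open>X\<close> is closed under subtracting \<open>t\<close>, and \<open>X\<close> is then determined by its
  \<open>t\<close> peaks, the elements \<open>x\<close> with \<open>x + t \<notin> X\<close>. The entries of the coding are the peaks,
  shifted by \<open>(t + 1) / 2\<close>. The number of pairs of peaks with difference \<open>k\<close> is the second
  difference \<open>M (k - t) + M (k + t) - 2 M k\<close>; this is an identity between multisets of
  integers. Multiplying \<open>\<tau>\<close> over both sides gives the product formula, and summing \<open>k\<^sup>2\<close> over
  both sides gives the size formula.
\<close>

subsection \<open>Maya diagrams and hook lengths\<close>

text \<open>Padding with zero parts gives every row index a bead, so \<open>maya l\<close> contains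
  all sufficiently small integers.\<close>

definition part :: "nat list \<Rightarrow> nat \<Rightarrow> nat" where
  "part l i = (if i < length l then l ! i else 0)"

definition column :: "nat list \<Rightarrow> nat \<Rightarrow> nat" where
  "column l j = card {i. j < part l i}"

definition bead :: "nat list \<Rightarrow> nat \<Rightarrow> int" where
  "bead l i = int (part l i) - int i - 1"

text \<open>Columns contribute gaps as rows contribute beads; the gaps turn out to fill exactly the
  complement of \<open>maya l\<close>.\<close>

definition gap :: "nat list \<Rightarrow> nat \<Rightarrow> int" where
  "gap l j = int j - int (column l j)"

definition maya :: "nat list \<Rightarrow> int set" where
  "maya l = range (bead l)"

text \<open>The argument ranges over all integers because the second difference used for cores also
  reaches zero and negative values, which are no hook lengths.\<close>

definition descents :: "int set \<Rightarrow> int \<Rightarrow> nat" where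
  "descents X k = card {x \<in> X. x - k \<notin> X}"

section \<open>Rows, columns, beads and gaps\<close>

lemma part_antimono:
  assumes "is_partition l" "i \<le> j"
  shows "part l j \<le> part l i"
  using assms by (cases "i = j") (auto simp: part_def is_partition_def sorted_wrt_iff_nth_less)

lemma part_pos_iff: "is_partition l \<Longrightarrow> 0 < part l i \<longleftrightarrow> i < length l"
  by (auto simp: part_def is_partition_def)

lemma boxes_conv_part: "boxes l = {(i, j). j < part l i}"
  by (auto simp: boxes_def part_def split: if_splits)

lemma finite_boxes [simp]: "finite (boxes l)"
proof -
  have "boxes l = Sigma {..<length l} (\<lambda>i. {..<l ! i})"
    by (auto simp: boxes_def)
  then show ?thesis by simp
qed

lemma card_boxes: "card (boxes l) = sum_list l"
proof -
  have "boxes l = Sigma {..<length l} (\<lambda>i. {..<l ! i})"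
    by (auto simp: boxes_def)
  then show ?thesis by (simp add: sum_list_sum_nth atLeast0LessThan)
qed

lemma down_closed_eq_lessThan_card:
  fixes A :: "nat set"
  assumes "finite A" "\<And>i j. j \<in> A \<Longrightarrow> i \<le> j \<Longrightarrow> i \<in> A"
  shows "A = {..<card A}"
proof (cases "A = {}")
  case False
  have "A = {..Max A}"
    using assms Max_in[OF assms(1) False] by (auto intro: Max_ge)
  then show ?thesis by (metis card_atMost lessThan_Suc_atMost)
qed simp

text \<open>Conjugation: both sides say that \<open>(i, j)\<close> is a box. The rows meeting column
  \<open>j\<close> form an initial segment because the parts decrease.\<close>

lemma less_part_iff:
  assumes "is_partition l"
  shows "j < part l i \<longleftrightarrow> i < column l j"
proof -
  have "{i. j < part l i} = {..<column l j}"
    unfolding column_def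
  proof (rule down_closed_eq_lessThan_card)
    show "finite {i. j < part l i}"
      by (rule finite_subset[of _ "{..<length l}"]) (auto simp: part_def split: if_splits)
    show "i \<in> {i. j < part l i}" if "k \<in> {i. j < part l i}" "i \<le> k" for i k
      using part_antimono[OF assms that(2)] that(1) by auto
  qed
  then show ?thesis by auto
qed

lemma bead_strict_antimono:
  assumes "is_partition l" "i < j"
  shows "bead l j < bead l i"
  using part_antimono[OF assms(1), of i j] assms(2) by (simp add: bead_def)

lemma bead_less_iff:
  assumes "is_partition l"
  shows "bead l i < bead l j \<longleftrightarrow> j < i"
  using bead_strict_antimono[OF assms] by (metis linorder_cases order_less_asym order_less_irrefl)

lemma inj_bead: "is_partition l \<Longrightarrow> inj (bead l)"
  by (metis bead_less_iff injI linorder_less_linear order_less_irrefl)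

lemma gap_strict_mono:
  assumes "is_partition l" "i < j"
  shows "gap l i < gap l j"
proof -
  have "column l j \<le> column l i"
    using less_part_iff[OF assms(1)] assms(2)
    by (metis less_trans linorder_not_le order_less_irrefl)
  then show ?thesis using assms(2) by (simp add: gap_def)
qed

lemma inj_gap: "is_partition l \<Longrightarrow> inj (gap l)"
  by (metis gap_strict_mono injI linorder_less_linear order_less_irrefl)

text \<open>Over the integers, \<open>bead l i - gap l j\<close> is
  \<open>(part l i - j) + (column l j - i) - 1\<close>. By \<open>less_part_iff\<close> the two
  brackets are both positive or both at most zero, so the difference is positive exactly for boxes
  and never zero.\<close>

lemma bead_greater_gap_iff:
  assumes "is_partition l"
  shows "bead l i > gap l j \<longleftrightarrow> j < part l i"
  using less_part_iff[OF assms, of j i] by (auto simp: bead_def gap_def)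

lemma bead_neq_gap:
  assumes "is_partition l"
  shows "bead l i \<noteq> gap l j"
  using less_part_iff[OF assms, of j i] by (auto simp: bead_def gap_def)

lemma bead_ge_iff:
  assumes "is_partition l" "length l \<le> N"
  shows "bead l i \<ge> - int N \<longleftrightarrow> i < N"
  using part_pos_iff[OF assms(1), of i] assms(2) by (auto simp: bead_def)

lemma maya_lower: "{..<- int (length l)} \<subseteq> maya l"
proof
  fix x assume "x \<in> {..<- int (length l)}"
  then have "x = bead l (nat (- x - 1))"
    by (auto simp: bead_def part_def)
  then show "x \<in> maya l" by (auto simp: maya_def)
qed

lemma maya_upper:
  assumes "is_partition l"
  shows "maya l \<subseteq> {..<int (part l 0)}"
proof
  fix x assume "x \<in> maya l"
  then obtain i where "x = bead l i" by (auto simp: maya_def)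
  then show "x \<in> {..<int (part l 0)}"
    using part_antimono[OF assms, of 0 i] by (simp add: bead_def)
qed

text \<open>This is the charge-zero condition, which separates Maya diagrams of partitions from
  their nontrivial translates.\<close>

lemma card_maya_atLeast:
  assumes "is_partition l" "length l \<le> N"
  shows "card (maya l \<inter> {- int N..}) = N"
proof -
  have "maya l \<inter> {- int N..} = bead l ` {..<N}"
    using bead_ge_iff[OF assms] by (auto simp: maya_def)
  then show ?thesis
    using inj_bead[OF assms(1)] by (simp add: card_image inj_on_subset)
qed

text \<open>If exactly \<open>c\<close> beads lie above \<open>z\<close>, then the column whose gap
  is \<open>z\<close> must have length \<open>c\<close> and hence index
  \<open>z + c\<close>.\<close>

lemma not_in_maya_imp_gap:
  assumes l: "is_partition l" and z: "z \<notin> maya l"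
  obtains j where "z = gap l j"
proof -
  define C where "C = {i. bead l i > z}"
  have "C = {..<card C}"
  proof (rule down_closed_eq_lessThan_card)
    have "i < length l + nat (- z)" if "i \<in> C" for i
      using that part_pos_iff[OF l, of i] unfolding C_def bead_def by auto
    then show "finite C" by (meson finite_nat_set_iff_bounded)
    show "i \<in> C" if "k \<in> C" "i \<le> k" for i k
      using bead_less_iff[OF l, of i k] that by (auto simp: C_def)
  qed
  then have C: "bead l i > z \<longleftrightarrow> i < card C" for i
    unfolding C_def by auto
  define c where "c = card C"
  have lt: "bead l c < z"
    using C[of c] z by (auto simp: c_def maya_def not_less order_le_less)
  \<comment> \<open>Since \<open>part l c\<close> is nonnegative, \<open>bead l c\<close> is at
    least \<open>- c - 1\<close>.\<close>
  then have nonneg: "z + int c \<ge> 0"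
    by (simp add: bead_def)
  define j where "j = nat (z + int c)"
  have j: "int j = z + int c" using nonneg by (simp add: j_def)
  have "i < column l j \<longleftrightarrow> i < c" for i
  proof -
    have "j < part l i" if "i < c"
    proof -
      have "j < part l (c - 1)" using C[of "c - 1"] that j by (auto simp: bead_def c_def)
      also have "\<dots> \<le> part l i" using that by (intro part_antimono[OF l]) auto
      finally show ?thesis .
    qed
    moreover have "\<not> j < part l i" if "c \<le> i"
    proof -
      have "part l i \<le> part l c" using that by (intro part_antimono[OF l])
      then show ?thesis using lt j by (simp add: bead_def)
    qed
    ultimately show ?thesis using less_part_iff[OF l] by (meson not_le)
  qed
  then have "column l j = c" by (metis linorder_cases order_less_irrefl)
  then show ?thesis using that[of j] j by (simp add: gap_def)
qed

lemma not_in_maya_iff: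
  assumes "is_partition l"
  shows "z \<notin> maya l \<longleftrightarrow> (\<exists>j. z = gap l j)"
  using not_in_maya_imp_gap[OF assms] bead_neq_gap[OF assms] by (metis maya_def rangeE)

section \<open>Hooks as pairs of a bead and a smaller gap\<close>

text \<open>The box with its arm has \<open>part l i - j\<close> elements and the leg has
  \<open>column l j - i - 1\<close>; their sum is the difference of bead and gap.\<close>

lemma hook_length_eq:
  assumes l: "is_partition l" and b: "(i, j) \<in> boxes l"
  shows "int (hook_length l (i, j)) = bead l i - gap l j"
proof -
  have ij: "j < part l i" "i < column l j"
    using b less_part_iff[OF l] by (auto simp: boxes_conv_part)
  have "hook l (i, j) = {i} \<times> {j..<part l i} \<union> {i<..<column l j} \<times> {j}"
    using ij less_part_iff[OF l] by (auto simp: hook_def boxes_conv_part)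
  moreover have "card \<dots> = (part l i - j) + (column l j - Suc i)"
    by (subst card_Un_disjoint) (auto simp: card_cartesian_product)
  ultimately show ?thesis
    using ij by (simp add: hook_length_def bead_def gap_def)
qed

text \<open>A box is sent to the bead of its row. Given the hook length \<open>k\<close>, the column
  is recovered from the gap \<open>k\<close> below that bead.\<close>

lemma hook_count_eq_descents:
  assumes l: "is_partition l" and k: "k > 0"
  shows "hook_count l k = descents (maya l) (int k)"
proof -
  have "bij_betw (\<lambda>b. bead l (fst b)) {b \<in> boxes l. hook_length l b = k}
          {x \<in> maya l. x - int k \<notin> maya l}"
  proof (rule bij_betwI')
    fix b c assume b: "b \<in> {b \<in> boxes l. hook_length l b = k}"
      and c: "c \<in> {b \<in> boxes l. hook_length l b = k}"
    obtain i j m n where [simp]: "b = (i, j)" "c = (m, n)" by (cases b, cases c)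
    have "bead l i - gap l j = bead l m - gap l n"
      using b c hook_length_eq[OF l] by (metis (mono_tags) \<open>b = (i, j)\<close> \<open>c = (m, n)\<close> mem_Collect_eq)
    then show "bead l (fst b) = bead l (fst c) \<longleftrightarrow> b = c"
      using inj_bead[OF l] inj_gap[OF l] by (auto dest: injD)
  next
    fix b assume "b \<in> {b \<in> boxes l. hook_length l b = k}"
    then have "bead l (fst b) - int k = gap l (snd b)"
      using hook_length_eq[OF l, of "fst b" "snd b"] by auto
    then show "bead l (fst b) \<in> {x \<in> maya l. x - int k \<notin> maya l}"
      using not_in_maya_iff[OF l] by (auto simp: maya_def)
  next
    fix x assume "x \<in> {x \<in> maya l. x - int k \<notin> maya l}"
    then obtain i j where x: "x = bead l i" "x - int k = gap l j"
      using not_in_maya_iff[OF l] by (auto simp: maya_def)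
    then have "j < part l i"
      using bead_greater_gap_iff[OF l, of j i] k by simp
    then have "(i, j) \<in> boxes l" by (simp add: boxes_conv_part)
    then have "(i, j) \<in> {b \<in> boxes l. hook_length l b = k}"
      using hook_length_eq[OF l] x by fastforce
    then show "\<exists>b\<in>{b \<in> boxes l. hook_length l b = k}. x = bead l (fst b)"
      using x by force
  qed
  then show ?thesis
    by (simp add: hook_count_def descents_def bij_betw_same_card)
qed

lemma count_image_mset_mset_set:
  "finite A \<Longrightarrow> count (image_mset f (mset_set A)) k = card {x \<in> A. f x = k}"
  by (simp add: count_image_mset vimage_def Int_def conj_commute)

lemma hook_length_pos:
  assumes "b \<in> boxes l"
  shows "hook_length l b > 0"
proof -
  have "b \<in> hook l b" using assms by (cases b) (auto simp: hook_def)
  moreover have "finite (hook l b)"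
    by (rule finite_subset[OF _ finite_boxes[of l]]) (auto simp: hook_def)
  ultimately show ?thesis by (auto simp: hook_length_def card_gt_0_iff)
qed

lemma count_hook_mset:
  assumes l: "is_partition l"
  shows "count (image_mset int (hook_mset l)) k = (if k > 0 then descents (maya l) k else 0)"
proof -
  have "count (image_mset int (hook_mset l)) k = card {b \<in> boxes l. int (hook_length l b) = k}"
    by (simp add: hook_mset_def image_mset.compositionality count_image_mset_mset_set)
  also have "\<dots> = (if k > 0 then descents (maya l) k else 0)"
  proof (cases "k > 0")
    case True
    then have "{b \<in> boxes l. int (hook_length l b) = k} = {b \<in> boxes l. hook_length l b = nat k}"
      by auto
    then show ?thesis
      using True hook_count_eq_descents[OF l, of "nat k"] by (simp add: hook_count_def)
  next
    case False
    then have "{b \<in> boxes l. int (hook_length l b) = k} = {}"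
      using hook_length_pos[of _ l] by force
    then show ?thesis using False by simp
  qed
  finally show ?thesis .
qed

section \<open>Partitions and their Maya diagrams\<close>

text \<open>The beads enumerate the diagram in decreasing order, so \<open>bead l i\<close> is its
  element of rank \<open>i\<close>, and the beads determine the parts.\<close>

lemma maya_inj:
  assumes l: "is_partition l" "is_partition m" and eq: "maya l = maya m"
  shows "l = m"
proof -
  have bead_eq: "bead l i = bead m i" for i
  proof (induction i rule: less_induct)
    case (less i)
    \<comment> \<open>Stated for arbitrary \<open>p\<close> and \<open>q\<close> so that it can be
      used in both directions, giving equality by antisymmetry.\<close>
    have le: "bead p i \<le> bead q i"
      if p: "is_partition p" and q: "is_partition q" and "maya p = maya q"
        and IH: "\<And>j. j < i \<Longrightarrow> bead p j = bead q j" for p q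
    proof -
      obtain k where k: "bead p i = bead q k"
        using \<open>maya p = maya q\<close> by (metis maya_def rangeE rangeI)
      have "\<not> k < i"
        using IH[of k] k bead_less_iff[OF p] by (metis order_less_irrefl)
      then show ?thesis
        using k bead_less_iff[OF q] by (metis linorder_not_le)
    qed
    show ?case
      using le[OF l(1) l(2) eq] le[OF l(2) l(1) eq[symmetric]] less by (metis order_antisym)
  qed
  have part_eq: "part l i = part m i" for i
    using bead_eq[of i] by (simp add: bead_def)
  then have "i < length l \<longleftrightarrow> i < length m" for i
    using part_pos_iff[OF l(1)] part_pos_iff[OF l(2)] by metis
  then have "length l = length m" by (metis linorder_cases order_less_irrefl)
  then show ?thesis
    using part_eq by (intro nth_equalityI) (auto simp: part_def, metis)
qed

lemma strict_desc_nth_diff: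
  fixes u :: "int list"
  assumes "sorted_wrt (>) u" "i \<le> j" "j < length u"
  shows "u ! i \<ge> u ! j + int (j - i)"
  using assms(2,3)
proof (induction j rule: dec_induct)
  case (step n)
  then have "u ! n > u ! Suc n"
    using assms(1) by (simp add: sorted_wrt_iff_nth_less)
  with step show ?case by (simp add: Suc_diff_le)
qed simp

text \<open>Listing the \<open>N\<close> elements from \<open>- N\<close> upwards in decreasing
  order and undoing the shift \<open>- i - 1\<close> yields the parts.\<close>

lemma exists_partition_of_maya:
  assumes lower: "{..<- int N} \<subseteq> X" and fin: "finite (X \<inter> {- int N..})"
    and card: "card (X \<inter> {- int N..}) = N"
  obtains l where "is_partition l" "maya l = X"
proof -
  define S where "S = X \<inter> {- int N..}"
  define u where "u = rev (sorted_list_of_set S)"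
  have len: "length u = N" using card by (simp add: u_def S_def)
  have set: "set u = S" using fin by (simp add: u_def S_def)
  have desc: "sorted_wrt (>) u"
    by (simp add: u_def sorted_wrt_rev strict_sorted_list_of_set)
  define p where "p i = u ! i + int i + 1" for i
  \<comment> \<open>The last listed element is at least \<open>- N\<close>, and each step back in
    the list gains at least one, so \<open>u ! i\<close> is at least \<open>- i - 1\<close>.\<close>
  have p_nonneg: "p i \<ge> 0" if "i < N" for i
  proof -
    have "u ! (N - 1) \<in> S" using that len nth_mem[of "N - 1" u] set by simp
    then have "u ! (N - 1) \<ge> - int N" by (simp add: S_def)
    moreover have "u ! i \<ge> u ! (N - 1) + int (N - 1 - i)"
      using that len by (intro strict_desc_nth_diff[OF desc]) auto
    ultimately show ?thesis using that by (simp add: p_def)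
  qed
  have p_antimono: "p j \<le> p i" if "i \<le> j" "j < N" for i j
    using strict_desc_nth_diff[OF desc that(1)] that len by (simp add: p_def)
  define w where "w = map (\<lambda>i. nat (p i)) [0..<N]"
  \<comment> \<open>Only positive parts may be kept; the zeros cut off here are exactly those that
    \<open>part\<close> restores.\<close>
  define l where "l = takeWhile (\<lambda>x. x > 0) w"
  have lenl: "length l \<le> N"
    unfolding l_def w_def by (metis length_map length_takeWhile_le length_upt minus_nat.diff_0)
  have l_nth: "l ! i = nat (p i)" if "i < length l" for i
    using that lenl unfolding l_def by (subst takeWhile_nth) (auto simp: w_def)
  have part: "part l i = nat (p i)" if "i < N" for i
  proof (cases "i < length l")
    case False
    then have "length l < N" using that by simp
    then have "\<not> 0 < w ! length l"
      unfolding l_def by (intro nth_length_takeWhile) (simp add: w_def)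
    then have "p (length l) \<le> 0" using \<open>length l < N\<close> by (simp add: w_def)
    then have "p i \<le> 0" using p_antimono[of "length l" i] False that by simp
    then show ?thesis using False by (simp add: part_def)
  qed (simp add: part_def l_nth)
  have "is_partition l"
    unfolding is_partition_def
  proof
    show "sorted_wrt (\<ge>) l"
      using l_nth lenl p_antimono by (auto simp: sorted_wrt_iff_nth_less nat_mono)
    show "\<forall>x\<in>set l. 0 < x" by (auto simp: l_def dest: set_takeWhileD)
  qed
  moreover have "maya l = X"
  proof -
    have "bead l i = u ! i" if "i < N" for i
      using part[OF that] p_nonneg[OF that] by (simp add: bead_def p_def)
    then have "bead l ` {..<N} = S"
      using set len by (auto simp: set_conv_nth)
    moreover have "bead l i = - int i - 1" if "i \<ge> N" for i
      using that lenl by (simp add: bead_def part_def)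
    then have "bead l ` {N..} = (\<lambda>i. - int i - 1) ` {N..}" by auto
    moreover have "(\<lambda>i. - int i - 1) ` {N..} = {..<- int N}"
    proof (intro equalityI subsetI)
      fix x assume "x \<in> {..<- int N}"
      then have "x = - int (nat (- x - 1)) - 1" "nat (- x - 1) \<in> {N..}" by auto
      then show "x \<in> (\<lambda>i. - int i - 1) ` {N..}" by blast
    qed auto
    moreover have "maya l = bead l ` {..<N} \<union> bead l ` {N..}"
      unfolding maya_def using not_le by fastforce
    ultimately show ?thesis using lower by (auto simp: S_def)
  qed
  ultimately show ?thesis using that by blast
qed


subsection \<open>Hook lengths of cores\<close>

definition peaks :: "nat \<Rightarrow> int set \<Rightarrow> int set" where
  "peaks t X = {x \<in> X. x + int t \<notin> X}"

section \<open>Second differences and symmetry of descents\<close>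

lemma finite_descents:
  fixes a b :: int
  assumes "{..<a} \<subseteq> X" "X \<subseteq> {..<b}"
  shows "finite {x \<in> X. x - k \<notin> X}"
proof (rule finite_subset)
  show "{x \<in> X. x - k \<notin> X} \<subseteq> {a + k..<b}"
  proof
    fix x assume x: "x \<in> {x \<in> X. x - k \<notin> X}"
    then have "x - k \<notin> {..<a}" "x \<in> {..<b}" using assms by blast+
    then show "x \<in> {a + k..<b}" by simp
  qed
qed simp

text \<open>The shift \<open>s\<close> lets several descent numbers be written as indicator sums
  over one common interval, to be combined termwise. The bounds on \<open>L\<close> and
  \<open>R\<close> ensure that no descent is missed.\<close>

lemma descents_window:
  assumes "{..<a} \<subseteq> X" "X \<subseteq> {..<b}" "L + s \<le> a + k" "b \<le> R + s"
  shows "int (descents X k) = (\<Sum>x\<in>{L..<R}. of_bool (x + s \<in> X \<and> x + s - k \<notin> X))"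
proof -
  have "{x \<in> X. x - k \<notin> X} = (\<lambda>x. x + s) ` ({L..<R} \<inter> {x. x + s \<in> X \<and> x + s - k \<notin> X})"
  proof (intro equalityI subsetI)
    fix x assume x: "x \<in> {x \<in> X. x - k \<notin> X}"
    then have "x - k \<ge> a" "x < b" using assms(1,2) by (auto simp: subset_iff not_less[symmetric])
    then show "x \<in> (\<lambda>x. x + s) ` ({L..<R} \<inter> {x. x + s \<in> X \<and> x + s - k \<notin> X})"
      using x assms(3,4) by (intro image_eqI[of _ _ "x - s"]) auto
  qed auto
  then have "descents X k = card ({L..<R} \<inter> {x. x + s \<in> X \<and> x + s - k \<notin> X})"
    by (simp add: descents_def card_image)
  then show ?thesis by simp
qed

text \<open>
  Discrete second difference: for \<open>f\<close> the indicator function of \<open>X\<close> and \<open>g = 1 - f\<close>, the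
  indicator function of the peaks is \<open>f x - f (x + t) = g (x + t) - g x\<close>, and \<open>descents X k\<close> is
  the sum of all \<open>f x * g (x - k)\<close>.
\<close>

lemma card_peak_pairs:
  assumes "{..<a} \<subseteq> X" "X \<subseteq> {..<b}"
    and closed: "\<And>x. x \<in> X \<Longrightarrow> x - int t \<in> X"
  shows "card {x \<in> peaks t X. x - k \<in> peaks t X} + 2 * descents X k =
    descents X (k - int t) + descents X (k + int t)"
proof -
  define L R where "L = a - \<bar>k\<bar> - 2 * int t" and "R = b + int t"
  have peaks: "peaks t X \<subseteq> {L..<R}"
  proof
    fix x assume "x \<in> peaks t X"
    then have "x + int t \<notin> {..<a}" "x \<in> {..<b}" using assms(1,2) by (auto simp: peaks_def)
    then show "x \<in> {L..<R}" by (simp add: L_def R_def)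
  qed
  have "int (card {x \<in> peaks t X. x - k \<in> peaks t X}) =
      (\<Sum>x\<in>{L..<R}. of_bool (x \<in> peaks t X \<and> x - k \<in> peaks t X))"
  proof -
    have "{x \<in> peaks t X. x - k \<in> peaks t X} =
        {L..<R} \<inter> {x. x \<in> peaks t X \<and> x - k \<in> peaks t X}"
      using peaks by auto
    then show ?thesis by simp
  qed
  \<comment> \<open>Expansion of \<open>(f x - f (x + t)) * (g (x - k + t) - g (x - k))\<close> into
    four products. The summands \<open>+ 0\<close> make the first two fit
    \<open>descents_window\<close> with shift zero.\<close>
  also have "\<dots> = (\<Sum>x\<in>{L..<R}.
      of_bool (x + 0 \<in> X \<and> x + 0 - (k - int t) \<notin> X) - of_bool (x + 0 \<in> X \<and> x + 0 - k \<notin> X)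
      - of_bool (x + int t \<in> X \<and> x + int t - k \<notin> X)
      + of_bool (x + int t \<in> X \<and> x + int t - (k + int t) \<notin> X))"
  proof (intro sum.cong refl)
    fix x
    have "x + int t \<in> X \<Longrightarrow> x \<in> X" "x - k + int t \<in> X \<Longrightarrow> x - k \<in> X"
      using closed[of "x + int t"] closed[of "x - k + int t"] by auto
    moreover have eqs: "x + int t - k = x - k + int t" "x - (k - int t) = x - k + int t"
      "x + int t - (k + int t) = x - k" by auto
    ultimately show "of_bool (x \<in> peaks t X \<and> x - k \<in> peaks t X) =
      (of_bool (x + 0 \<in> X \<and> x + 0 - (k - int t) \<notin> X) - of_bool (x + 0 \<in> X \<and> x + 0 - k \<notin> X)
      - of_bool (x + int t \<in> X \<and> x + int t - k \<notin> X)
      + of_bool (x + int t \<in> X \<and> x + int t - (k + int t) \<notin> X) :: int)"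
      unfolding eqs add_0_right peaks_def mem_Collect_eq by auto
  qed
  also have "\<dots> = int (descents X (k - int t)) - int (descents X k) - int (descents X k)
      + int (descents X (k + int t))"
    unfolding sum.distrib sum_subtractf
    by (intro arg_cong2[where f = "(+)"] arg_cong2[where f = "(-)"]
          descents_window[OF assms(1,2), symmetric])
       (simp_all add: L_def R_def)
  finally show ?thesis by simp
qed

text \<open>Compare \<open>X\<close> with its translate by \<open>m\<close>, both cut off below
  \<open>a\<close>. The translate has \<open>m\<close> more elements because \<open>X\<close>
  contains everything below \<open>a\<close>, and the two set differences are counted by the
  descents at \<open>m\<close> and at \<open>- m\<close>.\<close>

lemma descents_uminus:
  assumes "{..<a} \<subseteq> X" "X \<subseteq> {..<b}"
  shows "descents X (- int m) = descents X (int m) + m"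
proof -
  define P where "P = X \<inter> {a..}"
  define Q where "Q = (\<lambda>x. x + int m) ` (X \<inter> {a - int m..})"
  have fin: "finite (X \<inter> {c..})" for c
    by (rule finite_subset[of _ "{c..<b}"]) (use assms(2) in auto)
  have fPQ: "finite P" "finite Q" using fin by (auto simp: P_def Q_def)
  have "X \<inter> {a - int m..} = P \<union> {a - int m..<a}"
    using assms(1) by (auto simp: P_def)
  moreover have "card (P \<union> {a - int m..<a}) = card P + m"
    using fPQ(1) by (subst card_Un_disjoint) (auto simp: P_def)
  ultimately have cQ: "card Q = card P + m"
    by (simp add: Q_def card_image)
  have ge: "x \<ge> a" if "x \<notin> X" for x
    using assms(1) that by (metis lessThan_iff not_le subsetD)
  have Q: "x \<in> Q \<longleftrightarrow> x - int m \<in> X \<and> x \<ge> a" for x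
    unfolding Q_def by (auto intro!: image_eqI[of _ _ "x - int m"])
  have "P - Q = {x \<in> X. x - int m \<notin> X}"
  proof (intro equalityI subsetI)
    fix x assume "x \<in> {x \<in> X. x - int m \<notin> X}"
    then show "x \<in> P - Q" using ge[of "x - int m"] by (simp add: P_def Q)
  qed (auto simp: P_def Q)
  moreover have "Q - P = (\<lambda>x. x + int m) ` {x \<in> X. x - (- int m) \<notin> X}"
  proof (intro equalityI subsetI)
    fix x assume "x \<in> Q - P"
    then have "x - int m \<in> X" "x \<notin> X" by (auto simp: P_def Q)
    then show "x \<in> (\<lambda>x. x + int m) ` {x \<in> X. x - (- int m) \<notin> X}"
      by (intro image_eqI[of _ _ "x - int m"]) simp_all
  next
    fix x assume "x \<in> (\<lambda>x. x + int m) ` {x \<in> X. x - (- int m) \<notin> X}"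
    then obtain y where "x = y + int m" "y \<in> X" "y + int m \<notin> X" by auto
    then show "x \<in> Q - P" using ge[of "y + int m"] by (simp add: P_def Q)
  qed
  ultimately have "card (P - Q) = descents X (int m)" "card (Q - P) = descents X (- int m)"
    by (simp_all add: descents_def card_image)
  moreover have "card P + card (Q - P) = card Q + card (P - Q)"
    using card_Un_disjoint[of P "Q - P"] card_Un_disjoint[of Q "P - Q"] fPQ
    by (simp add: Un_commute)
  ultimately show ?thesis using cQ by simp
qed

section \<open>Cores as sets closed under subtraction\<close>

lemma descents_eq_0_iff:
  fixes a b :: int
  assumes "{..<a} \<subseteq> X" "X \<subseteq> {..<b}"
  shows "descents X k = 0 \<longleftrightarrow> (\<forall>x\<in>X. x - k \<in> X)"
  using finite_descents[OF assms] by (auto simp: descents_def)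

lemma closed_minus_mult:
  assumes "\<And>x. x \<in> X \<Longrightarrow> x - int t \<in> X" "x \<in> X"
  shows "x - int t * int n \<in> X"
proof (induction n)
  case (Suc n)
  then show ?case using assms(1)[of "x - int t * int n"] by (simp add: algebra_simps)
qed (use assms in simp)

text \<open>A number \<open>h > 0\<close> is missing from the hook lengths iff subtracting
  \<open>h\<close> preserves the Maya diagram. Preservation under \<open>t\<close> passes to all
  multiples of \<open>t\<close>, so the single value \<open>t\<close> decides.\<close>

lemma is_core_iff_closed:
  assumes "t > 0"
  shows "is_core t l \<longleftrightarrow> is_partition l \<and> (\<forall>x\<in>maya l. x - int t \<in> maya l)"
proof (cases "is_partition l")
  case l: True
  note bounds = maya_lower[of l] maya_upper[OF l]
  have mem: "h \<in># hook_mset l \<longleftrightarrow> h > 0 \<and> \<not> (\<forall>x\<in>maya l. x - int h \<in> maya l)" for h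
  proof -
    have "h \<in># hook_mset l \<longleftrightarrow> int h \<in># image_mset int (hook_mset l)" by auto
    also have "\<dots> \<longleftrightarrow> h > 0 \<and> descents (maya l) (int h) \<noteq> 0"
      using count_hook_mset[OF l, of "int h"] by (metis count_eq_zero_iff of_nat_0_less_iff)
    finally show ?thesis using descents_eq_0_iff[OF bounds] by simp
  qed
  have "is_core t l \<longleftrightarrow> (\<forall>h\<in>#hook_mset l. \<not> t dvd h)"
    using l by (simp add: is_core_def)
  also have "\<dots> \<longleftrightarrow> (\<forall>x\<in>maya l. x - int t \<in> maya l)"
  proof
    assume "\<forall>h\<in>#hook_mset l. \<not> t dvd h"
    then show "\<forall>x\<in>maya l. x - int t \<in> maya l"
      using mem[of t] assms by (meson dvd_refl)
  next
    assume "\<forall>x\<in>maya l. x - int t \<in> maya l"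
    then have "x - int t * int n \<in> maya l" if "x \<in> maya l" for x n
      using closed_minus_mult[of "maya l" t x n] that by blast
    then show "\<forall>h\<in>#hook_mset l. \<not> t dvd h"
      using mem by (auto simp: dvd_def)
  qed
  finally show ?thesis using l by simp
qed (simp add: is_core_def)

section \<open>The multiset identity\<close>

lemma count_sum_replicate_mset:
  assumes "finite A" "inj_on g A" "i \<in> A"
  shows "count (\<Sum>i\<in>A. replicate_mset (n i) (g i)) (g i) = n i"
proof -
  have "count (\<Sum>i\<in>A. replicate_mset (n i) (g i)) (g i) = (\<Sum>j\<in>A. if j = i then n j else 0)"
    unfolding count_sum using assms by (intro sum.cong) (auto dest: inj_onD)
  then show ?thesis using assms by simp
qed

lemma count_sum_replicate_mset_0:
  assumes "k \<notin> g ` A"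
  shows "count (\<Sum>i\<in>A. replicate_mset (n i) (g i)) k = 0"
  unfolding count_sum using assms by (intro sum.neutral) auto

lemma count_image_mset_add_right:
  fixes M :: "int multiset"
  shows "count (image_mset (\<lambda>h. h + c) M) k = count M (k - c)"
  by (induction M) auto

lemma count_image_mset_diff_right:
  fixes M :: "int multiset"
  shows "count (image_mset (\<lambda>h. h - c) M) k = count M (k + c)"
  using count_image_mset_add_right[of "- c" M k] by simp

text \<open>Entries of a strictly decreasing list determine their positions, and the earlier
  position carries the larger entry; so index pairs with difference \<open>k\<close> are value
  pairs.\<close>

lemma count_differences:
  fixes u :: "int list"
  assumes desc: "sorted_wrt (>) u"
  shows "count (image_mset (\<lambda>(i, j). u ! i - u ! j) (mset_set {(i, j). i < j \<and> j < length u})) k =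
    (if k > 0 then card {x \<in> set u. x - k \<in> set u} else 0)"
proof -
  define A where "A = {(i, j). i < j \<and> j < length u}"
  have less: "u ! j < u ! i \<longleftrightarrow> i < j" if "i < length u" "j < length u" for i j
    using desc that by (metis linorder_cases order_less_asym order_less_irrefl sorted_wrt_iff_nth_less)
  have inj: "u ! i = u ! j \<longleftrightarrow> i = j" if "i < length u" "j < length u" for i j
    using less that by (metis linorder_cases order_less_irrefl)
  have "finite A"
    by (rule finite_subset[of _ "{..<length u} \<times> {..<length u}"]) (auto simp: A_def)
  then have "count (image_mset (\<lambda>(i, j). u ! i - u ! j) (mset_set A)) k =
      card {p \<in> A. (case p of (i, j) \<Rightarrow> u ! i - u ! j) = k}"
    by (rule count_image_mset_mset_set)
  also have "\<dots> = (if k > 0 then card {x \<in> set u. x - k \<in> set u} else 0)"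
  proof (cases "k > 0")
    case True
    have "bij_betw (\<lambda>p. u ! fst p) {p \<in> A. (case p of (i, j) \<Rightarrow> u ! i - u ! j) = k}
            {x \<in> set u. x - k \<in> set u}"
    proof (rule bij_betwI')
      fix p q assume p: "p \<in> {p \<in> A. (case p of (i, j) \<Rightarrow> u ! i - u ! j) = k}"
        and q: "q \<in> {p \<in> A. (case p of (i, j) \<Rightarrow> u ! i - u ! j) = k}"
      obtain i j m n where eq: "p = (i, j)" "q = (m, n)" by (cases p, cases q)
      with p q have lt: "i < length u" "j < length u" "m < length u" "n < length u"
        and k: "u ! i - u ! j = u ! m - u ! n"
        by (auto simp: A_def)
      have "i = m \<and> j = n" if "u ! i = u ! m"
        using that k inj[OF lt(1,3)] inj[OF lt(2,4)] by simp
      then show "u ! fst p = u ! fst q \<longleftrightarrow> p = q"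
        by (auto simp: eq)
    next
      fix p assume "p \<in> {p \<in> A. (case p of (i, j) \<Rightarrow> u ! i - u ! j) = k}"
      then show "u ! fst p \<in> {x \<in> set u. x - k \<in> set u}"
        by (cases p) (auto simp: A_def)
    next
      fix x assume "x \<in> {x \<in> set u. x - k \<in> set u}"
      then obtain i j where ij: "i < length u" "j < length u" "x = u ! i" "x - k = u ! j"
        by (metis (mono_tags, lifting) in_set_conv_nth mem_Collect_eq)
      then have "i < j" using less[of i j] True by auto
      with ij show "\<exists>p\<in>{p \<in> A. (case p of (i, j) \<Rightarrow> u ! i - u ! j) = k}. x = u ! fst p"
        by (intro bexI[of _ "(i, j)"]) (auto simp: A_def)
    qed
    then show ?thesis using True by (simp add: bij_betw_same_card)
  next
    case False
    have "{p \<in> A. (case p of (i, j) \<Rightarrow> u ! i - u ! j) = k} = {}"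
    proof -
      have "u ! i - u ! j > 0" if "(i, j) \<in> A" for i j
        using less[of i j] that by (auto simp: A_def)
      then show ?thesis using False by auto
    qed
    then show ?thesis by (simp only: False if_False card.empty)
  qed
  finally show ?thesis by (simp only: A_def)
qed

text \<open>Multiplicities of each \<open>k\<close> are compared via \<open>card_peak_pairs\<close>.
  Hook lengths see descents at positive arguments only: for \<open>0 < k < t\<close> the term at
  \<open>k - t\<close> is missing and is supplied by the third summand through
  \<open>descents_uminus\<close>, while for \<open>- t < k < 0\<close> the surplus from
  \<open>h - t\<close> is balanced by the negative entries on the right.\<close>

lemma core_hook_multiset:
  fixes l :: "nat list" and u :: "int list"
  assumes t: "t > 0" and core: "is_core t l"
    and u: "sorted_wrt (>) u" "set u = peaks t (maya l)" "length u = t"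
  defines "H \<equiv> image_mset int (hook_mset l)"
  shows "image_mset (\<lambda>h. h - int t) H + image_mset (\<lambda>h. h + int t) H +
      (\<Sum>i=1..t-1. replicate_mset (hook_count l (t - i) + (t - i)) (int i)) =
    H + H + (\<Sum>i=1..t-1. replicate_mset (hook_count l (t - i)) (- int i)) +
      image_mset (\<lambda>(i, j). u ! i - u ! j) (mset_set {(i, j). i < j \<and> j < t})"
    (is "?A + ?B + ?C = H + H + ?E + ?F")
proof (rule multiset_eqI)
  fix k
  have l: "is_partition l" and closed: "\<And>x. x \<in> maya l \<Longrightarrow> x - int t \<in> maya l"
    using core is_core_iff_closed[OF t] by auto
  note bounds = maya_lower[of l] maya_upper[OF l]
  let ?M = "descents (maya l)"
  let ?D = "card {x \<in> peaks t (maya l). x - k \<in> peaks t (maya l)}"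
  have H: "count H k = (if k > 0 then ?M k else 0)" for k
    unfolding H_def by (rule count_hook_mset[OF l])
  have A: "count ?A k = count H (k + int t)" and B: "count ?B k = count H (k - int t)"
    by (rule count_image_mset_diff_right count_image_mset_add_right)+
  have F: "count ?F k = (if k > 0 then ?D else 0)"
    using count_differences[OF u(1), of k] u(2,3) by simp
  have D: "?D + 2 * ?M k = ?M (k - int t) + ?M (k + int t)"
    by (rule card_peak_pairs[OF bounds closed])
  \<comment> \<open>These two values settle the boundary cases \<open>k = 0\<close> and
    \<open>k = t\<close>.\<close>
  have M0: "?M 0 = 0" "?M (int t) = 0"
    using closed descents_eq_0_iff[OF bounds] by auto
  have C: "count ?C k = (if 0 < k \<and> k < int t then ?M (int t - k) + nat (int t - k) else 0)"
  proof (cases "0 < k \<and> k < int t")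
    case True
    define i where "i = nat k"
    have i: "k = int i" "i \<in> {1..t-1}" "i < t" using True by (auto simp: i_def)
    have "count ?C (int i) = hook_count l (t - i) + (t - i)"
      using i(2) by (intro count_sum_replicate_mset) auto
    then show ?thesis
      using i hook_count_eq_descents[OF l, of "t - i"] by (simp add: of_nat_diff nat_diff_distrib)
  next
    case False
    then have "k \<notin> int ` {1..t-1}" using t by auto
    then show ?thesis using False by (subst count_sum_replicate_mset_0) auto
  qed
  have E: "count ?E k = (if k < 0 \<and> - int t < k then ?M (k + int t) else 0)"
  proof (cases "k < 0 \<and> - int t < k")
    case True
    define i where "i = nat (- k)"
    have i: "k = - int i" "i \<in> {1..t-1}" "i < t" using True by (auto simp: i_def)
    have "count ?E (- int i) = hook_count l (t - i)"
      using i(2) by (intro count_sum_replicate_mset) (auto simp: inj_on_def)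
    then show ?thesis
      using i hook_count_eq_descents[OF l, of "t - i"] by (simp add: of_nat_diff)
  next
    case False
    then have "k \<notin> (\<lambda>i. - int i) ` {1..t-1}" using t by auto
    then show ?thesis using False by (subst count_sum_replicate_mset_0) auto
  qed
  have neg: "?M (k - int t) = ?M (int t - k) + nat (int t - k)" if "k < int t"
    using descents_uminus[OF bounds, of "nat (int t - k)"] that by simp
  \<comment> \<open>With the counts named, each case is linear arithmetic.\<close>
  define p q r s d where "p = ?M (k - int t)" and "q = ?M (k + int t)" and "r = ?M k"
    and "s = ?M (int t - k)" and "d = ?D"
  note defs = p_def q_def r_def s_def d_def
  have "d + 2 * r = p + q" "k < int t \<longrightarrow> p = s + nat (int t - k)"
    "k = 0 \<longrightarrow> r = 0 \<and> q = 0" "k = int t \<longrightarrow> p = 0"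
    using D neg M0 by (auto simp: defs)
  then have "count ?A k + count ?B k + count ?C k =
      count H k + count H k + count ?E k + count ?F k"
    unfolding A B C E F H defs[symmetric] using t by (simp split: if_split) linarith
  then show "count (?A + ?B + ?C) k = count (H + H + ?E + ?F) k"
    by simp
qed


subsection \<open>Cores and transversals modulo the core parameter\<close>

definition transversal :: "nat \<Rightarrow> int set \<Rightarrow> bool" where
  "transversal t U \<longleftrightarrow> bij_betw (\<lambda>x. x mod int t) U {0..<int t}"

text \<open>These are the abacus runners filled downwards from their top positions \<open>U\<close>;
  the construction is inverse to \<open>peaks\<close>.\<close>

definition runners :: "nat \<Rightarrow> int set \<Rightarrow> int set" where
  "runners t U = {x - int t * int n | x n. x \<in> U}"

section \<open>Peaks and runners as inverse constructions\<close>

lemma mod_eq_imp_add_mult: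
  fixes x y :: int
  assumes "x mod int t = y mod int t" "x \<le> y" "t > 0"
  obtains n :: nat where "y = x + int t * int n"
proof -
  obtain k where k: "y - x = int t * k"
    using assms(1) by (metis dvd_def mod_eq_dvd_iff)
  then have "k \<ge> 0" using assms(2,3)
    by (metis diff_ge_0_iff_ge of_nat_0_less_iff zero_le_mult_iff less_le_not_le)
  then have "y = x + int t * int (nat k)" using k by simp
  then show ?thesis using that by blast
qed

text \<open>Descending by \<open>t\<close> from a larger element of the same class would reach
  \<open>x + t\<close>. Hence a peak is the maximum of its class.\<close>

lemma peak_upper:
  assumes "t > 0" "\<And>x. x \<in> X \<Longrightarrow> x - int t \<in> X"
    and "x \<in> peaks t X" "y \<in> X" "x mod int t = y mod int t"
  shows "y \<le> x"
proof (rule ccontr)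
  assume "\<not> y \<le> x"
  then obtain n where n: "y = x + int t * int n"
    using mod_eq_imp_add_mult[of x t y] assms(1,5) by auto
  with \<open>\<not> y \<le> x\<close> obtain m where "n = Suc m" by (cases n) auto
  then have "x + int t = y - int t * int m" using n by (simp add: algebra_simps)
  then have "x + int t \<in> X" using closed_minus_mult[OF assms(2,4), of m] by simp
  then show False using assms(3) by (simp add: peaks_def)
qed

lemma exists_peak:
  assumes "t > 0" "X \<subseteq> {..<b}" "y \<in> X"
  obtains n :: nat where "y + int t * int n \<in> peaks t X"
proof -
  define A where "A = {n :: nat. y + int t * int n \<in> X}"
  have "n < nat (b - y)" if "n \<in> A" for n
  proof -
    have "y + int t * int n < b" using that assms(2) by (auto simp: A_def)
    moreover have "int n \<le> int t * int n"
      using assms(1) mult_right_mono[of 1 "int t" "int n"] by simp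
    ultimately show ?thesis by linarith
  qed
  then have fin: "finite A" by (meson finite_nat_set_iff_bounded)
  moreover have "0 \<in> A" using assms(3) by (simp add: A_def)
  ultimately have "Max A \<in> A" by (intro Max_in) auto
  moreover have "Suc (Max A) \<notin> A" using Max_ge[OF fin] by (metis Suc_n_not_le_n)
  ultimately have "y + int t * int (Max A) \<in> peaks t X"
    by (simp add: A_def peaks_def algebra_simps)
  then show ?thesis using that by blast
qed

text \<open>Every class meets \<open>X\<close> far below, and climbing from there ends at a peak
  because \<open>X\<close> is bounded above; uniqueness is \<open>peak_upper\<close>.\<close>

lemma transversal_peaks:
  assumes t: "t > 0" and bounds: "{..<a} \<subseteq> X" "X \<subseteq> {..<b}"
    and closed: "\<And>x. x \<in> X \<Longrightarrow> x - int t \<in> X"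
  shows "transversal t (peaks t X)"
  unfolding transversal_def
proof (rule bij_betw_imageI)
  show "inj_on (\<lambda>x. x mod int t) (peaks t X)"
  proof (rule inj_onI)
    fix x y assume "x \<in> peaks t X" "y \<in> peaks t X" "x mod int t = y mod int t"
    then show "x = y"
      using peak_upper[OF t closed, of x y] peak_upper[OF t closed, of y x]
      by (simp add: peaks_def)
  qed
  show "(\<lambda>x. x mod int t) ` peaks t X = {0..<int t}"
  proof (intro equalityI subsetI)
    fix r assume r: "r \<in> {0..<int t}"
    \<comment> \<open>Large enough that \<open>r - t * m\<close> lies below \<open>a\<close>, hence
      in \<open>X\<close>.\<close>
    define m where "m = nat (\<bar>a\<bar> + r + 1)"
    have "int m \<le> int t * int m"
      using t mult_right_mono[of 1 "int t" "int m"] by simp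
    moreover have "int m = \<bar>a\<bar> + r + 1" using r by (simp add: m_def)
    ultimately have "r - int t * int m < a" by linarith
    then have "r - int t * int m \<in> X" using bounds by auto
    then obtain n where "r - int t * int m + int t * int n \<in> peaks t X"
      using exists_peak[OF t bounds(2)] by blast
    moreover have "(r - int t * int m + int t * int n) mod int t = r"
    proof -
      have "r - int t * int m + int t * int n = r + int t * (int n - int m)"
        by (simp add: algebra_simps)
      then show ?thesis using r by (simp only: mod_mult_self2) simp
    qed
    ultimately show "r \<in> (\<lambda>x. x mod int t) ` peaks t X" by (metis image_eqI)
  qed (use t in auto)
qed

lemma runners_peaks:
  assumes "t > 0" "X \<subseteq> {..<b}" "\<And>x. x \<in> X \<Longrightarrow> x - int t \<in> X"
  shows "runners t (peaks t X) = X"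
proof (intro equalityI subsetI)
  fix x assume "x \<in> runners t (peaks t X)"
  then show "x \<in> X"
    using closed_minus_mult[OF assms(3)] by (auto simp: runners_def peaks_def)
next
  fix x assume "x \<in> X"
  then obtain n where n: "x + int t * int n \<in> peaks t X"
    using exists_peak[OF assms(1,2)] by blast
  have "x = (x + int t * int n) - int t * int n" by simp
  then show "x \<in> runners t (peaks t X)"
    using n unfolding runners_def by blast
qed

lemma runners_closed:
  assumes "x \<in> runners t U"
  shows "x - int t \<in> runners t U"
proof -
  obtain y n where "x = y - int t * int n" "y \<in> U"
    using assms by (auto simp: runners_def)
  then have "x - int t = y - int t * int (Suc n)" by (simp add: algebra_simps)
  then show ?thesis using \<open>y \<in> U\<close> unfolding runners_def by blast
qed

lemma peaks_runners:
  assumes t: "t > 0" and U: "transversal t U"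
  shows "peaks t (runners t U) = U"
proof (intro equalityI subsetI)
  fix x assume x: "x \<in> peaks t (runners t U)"
  then obtain y n where y: "x = y - int t * int n" "y \<in> U"
    by (auto simp: peaks_def runners_def)
  have "n = 0"
  proof (rule ccontr)
    assume "n \<noteq> 0"
    then have "x + int t = y - int t * int (n - 1)"
      using y by (simp add: of_nat_diff algebra_simps)
    then have "x + int t \<in> runners t U" using y(2) unfolding runners_def by blast
    then show False using x by (simp add: peaks_def)
  qed
  then show "x \<in> U" using y by simp
next
  fix x assume x: "x \<in> U"
  then have "x - int t * int 0 \<in> runners t U" unfolding runners_def by blast
  moreover have "x + int t \<notin> runners t U"
  proof
    assume "x + int t \<in> runners t U"
    then obtain y n where y: "x + int t = y - int t * int n" "y \<in> U"
      by (auto simp: runners_def)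
    then have "y = x + int t * (int n + 1)" by (simp add: algebra_simps)
    then have "y mod int t = x mod int t" by simp
    then have "y = x"
      using U x y(2) by (auto simp: transversal_def bij_betw_def dest: inj_onD)
    then show False using y(1) t by (smt (verit) of_nat_0_less_iff zero_le_mult_iff of_nat_0_le_iff)
  qed
  ultimately show "x \<in> peaks t (runners t U)" by (simp add: peaks_def)
qed

section \<open>The balance condition on peaks\<close>

lemma transversal_finite: "transversal t U \<Longrightarrow> finite U"
  by (simp add: transversal_def bij_betw_finite)

lemma transversal_card: "transversal t U \<Longrightarrow> card U = t"
  using bij_betw_same_card by (fastforce simp: transversal_def)

lemma runners_lower:
  assumes t: "t > 0" and U: "transversal t U" and N: "\<And>x. x \<in> U \<Longrightarrow> - int N \<le> x"
  shows "{..<- int N} \<subseteq> runners t U"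
proof
  fix z assume z: "z \<in> {..<- int N}"
  have "z mod int t \<in> {0..<int t}" using t by simp
  then obtain x where x: "x \<in> U" "x mod int t = z mod int t"
    using U unfolding transversal_def bij_betw_def by (metis (no_types, lifting) imageE)
  then obtain n where "x = z + int t * int n"
    using mod_eq_imp_add_mult[of z t x] t z N[OF x(1)] by auto
  then have "z = x - int t * int n" by simp
  then show "z \<in> runners t U" using x(1) unfolding runners_def by blast
qed

lemma sum_int_atLeastLessThan: "2 * (\<Sum>r\<in>{0..<int t}. r) = int t * (int t - 1)"
proof (induction t)
  case (Suc t)
  have "{0..<int (Suc t)} = insert (int t) {0..<int t}" by auto
  with Suc show ?case by (simp add: algebra_simps)
qed simp

text \<open>The runner of \<open>x\<close> has \<open>(x + N) div t + 1\<close> elements from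
  \<open>- N\<close> upwards. As \<open>t\<close> divides \<open>N\<close>, multiplying the quotient
  by \<open>t\<close> gives \<open>x + N - x mod t\<close>, and over a transversal the residues add
  up to \<open>t * (t - 1) / 2\<close>. The formula is doubled to stay in the integers.\<close>

lemma card_runners:
  assumes t: "t > 0" and U: "transversal t U" and N: "\<And>x. x \<in> U \<Longrightarrow> - int N \<le> x"
    and dvd: "t dvd N"
  shows "finite (runners t U \<inter> {- int N..})"
    and "2 * int t * int (card (runners t U \<inter> {- int N..})) =
      2 * \<Sum>U + 2 * int t * int N + int t * (int t + 1)"
proof -
  note fin = transversal_finite[OF U]
  define q where "q x = nat ((x + int N) div int t + 1)" for x
  define B where "B = (SIGMA x:U. {..<q x})"
  have q: "int (q x) = (x + int N) div int t + 1" if "x \<in> U" for x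
    using N[OF that] t by (simp add: q_def pos_imp_zdiv_nonneg_iff)
  have less_q: "n < q x \<longleftrightarrow> x - int t * int n \<ge> - int N" if "x \<in> U" for x n
  proof -
    have "n < q x \<longleftrightarrow> int n \<le> (x + int N) div int t" using q[OF that] by linarith
    also have "\<dots> \<longleftrightarrow> int t * int n \<le> x + int N"
    proof
      assume "int n \<le> (x + int N) div int t"
      then have "int t * int n \<le> int t * ((x + int N) div int t)" by (intro mult_left_mono) auto
      also have "\<dots> \<le> x + int N"
        using t by (metis minus_mod_eq_mult_div pos_mod_sign of_nat_0_less_iff diff_left_mono diff_zero)
      finally show "int t * int n \<le> x + int N" .
    next
      assume "int t * int n \<le> x + int N"
      then have "(int t * int n) div int t \<le> (x + int N) div int t" using t by (intro zdiv_mono1) auto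
      then show "int n \<le> (x + int N) div int t" using t by simp
    qed
    finally show ?thesis by linarith
  qed
  have image: "runners t U \<inter> {- int N..} = (\<lambda>(x, n). x - int t * int n) ` B"
  proof (intro equalityI subsetI)
    fix z assume z: "z \<in> runners t U \<inter> {- int N..}"
    then obtain x n where "z = x - int t * int n" "x \<in> U" by (auto simp: runners_def)
    then show "z \<in> (\<lambda>(x, n). x - int t * int n) ` B"
      using less_q[of x n] z by (intro image_eqI[of _ _ "(x, n)"]) (auto simp: B_def)
  next
    fix z assume "z \<in> (\<lambda>(x, n). x - int t * int n) ` B"
    then obtain x n where "z = x - int t * int n" "x \<in> U" "n < q x" by (auto simp: B_def)
    then show "z \<in> runners t U \<inter> {- int N..}"
      using less_q[of x n] unfolding runners_def by auto
  qed
  have "finite B" using fin by (simp add: B_def)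
  then show "finite (runners t U \<inter> {- int N..})" by (simp add: image)
  \<comment> \<open>Runners of different elements of a transversal lie in different classes.\<close>
  have "inj_on (\<lambda>(x, n). x - int t * int n) B"
  proof (rule inj_onI, clarsimp simp: B_def)
    fix x m y n assume xy: "x \<in> U" "y \<in> U" and eq: "x - int t * int m = y - int t * int n"
    then have "x = y + int t * (int m - int n)" by (simp add: algebra_simps)
    then have "x mod int t = y mod int t" by simp
    then have "x = y"
      using U xy by (auto simp: transversal_def bij_betw_def dest: inj_onD)
    then show "x = y \<and> m = n" using eq t by simp
  qed
  then have "int (card (runners t U \<inter> {- int N..})) = (\<Sum>x\<in>U. int (q x))"
    using fin by (simp add: image card_image B_def)
  then have "int t * int (card (runners t U \<inter> {- int N..})) = (\<Sum>x\<in>U. int t * int (q x))"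
    by (simp add: sum_distrib_left)
  also have "\<dots> = (\<Sum>x\<in>U. x + (int N + int t) - x mod int t)"
  proof (intro sum.cong refl)
    fix x assume "x \<in> U"
    have "(x + int N) mod int t = x mod int t"
      using dvd by (auto simp: dvd_def)
    then have "int t * ((x + int N) div int t) = x + int N - x mod int t"
      by (metis minus_mod_eq_mult_div)
    then show "int t * int (q x) = x + (int N + int t) - x mod int t"
      using q[OF \<open>x \<in> U\<close>] by (simp add: algebra_simps)
  qed
  also have "\<dots> = \<Sum>U + int t * (int N + int t) - (\<Sum>x\<in>U. x mod int t)"
    using transversal_card[OF U] by (simp add: sum.distrib sum_subtractf)
  also have "(\<Sum>x\<in>U. x mod int t) = (\<Sum>r\<in>{0..<int t}. r)"
    using U unfolding transversal_def by (rule sum.reindex_bij_betw)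
  finally show "2 * int t * int (card (runners t U \<inter> {- int N..})) =
      2 * \<Sum>U + 2 * int t * int N + int t * (int t + 1)"
    using sum_int_atLeastLessThan[of t] by (simp add: algebra_simps)
qed

text \<open>By \<open>card_runners\<close>, the sum condition says that the filled runners have
  charge zero.\<close>

definition balanced_transversal :: "nat \<Rightarrow> int set \<Rightarrow> bool" where
  "balanced_transversal t U \<longleftrightarrow> transversal t U \<and> 2 * \<Sum>U = - (int t * (int t + 1))"

lemma exists_lower_bound_multiple:
  fixes U :: "int set"
  assumes "finite U" "t > 0"
  obtains N where "t dvd N" "c \<le> N" "\<forall>x\<in>U. - int N \<le> x"
proof -
  define m where "m = c + nat (\<Sum>x\<in>U. \<bar>x\<bar>)"
  have "m \<le> t * m" using assms(2) by (cases t) auto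
  have "- int (t * m) \<le> x" if "x \<in> U" for x
  proof -
    have "\<bar>x\<bar> \<le> (\<Sum>x\<in>U. \<bar>x\<bar>)" using assms(1) that by (intro member_le_sum) auto
    then show ?thesis using \<open>m \<le> t * m\<close> unfolding m_def by linarith
  qed
  moreover have "c \<le> m" by (simp add: m_def)
  then have "c \<le> t * m" using \<open>m \<le> t * m\<close> by (rule order_trans)
  ultimately show ?thesis using that[of "t * m"] by simp
qed

text \<open>Peaks determine the core through \<open>runners\<close>. Counting the elements from
  \<open>- N\<close> upwards in two ways forces the balance condition, and conversely that condition
  provides the count from which \<open>exists_partition_of_maya\<close> builds a partition.\<close>

lemma bij_betw_core_peaks:
  assumes t: "t > 0"
  shows "bij_betw (\<lambda>l. peaks t (maya l)) {l. is_core t l} {U. balanced_transversal t U}"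
proof (rule bij_betwI')
  fix l m assume "l \<in> {l. is_core t l}" "m \<in> {l. is_core t l}"
  then have l: "is_partition l" "\<forall>x\<in>maya l. x - int t \<in> maya l"
    and m: "is_partition m" "\<forall>x\<in>maya m. x - int t \<in> maya m"
    using is_core_iff_closed[OF t] by auto
  show "peaks t (maya l) = peaks t (maya m) \<longleftrightarrow> l = m"
  proof
    assume eq: "peaks t (maya l) = peaks t (maya m)"
    have "maya l = runners t (peaks t (maya l))"
      by (rule runners_peaks[OF t maya_upper[OF l(1)], symmetric]) (use l(2) in blast)
    also have "\<dots> = maya m"
      unfolding eq by (rule runners_peaks[OF t maya_upper[OF m(1)]]) (use m(2) in blast)
    finally show "l = m" by (rule maya_inj[OF l(1) m(1)])
  qed simp
next
  fix l assume "l \<in> {l. is_core t l}"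
  then have l: "is_partition l" and closed: "\<And>x. x \<in> maya l \<Longrightarrow> x - int t \<in> maya l"
    using is_core_iff_closed[OF t] by auto
  let ?U = "peaks t (maya l)"
  have U: "transversal t ?U"
    by (rule transversal_peaks[OF t maya_lower maya_upper[OF l] closed])
  have maya: "runners t ?U = maya l"
    by (rule runners_peaks[OF t maya_upper[OF l] closed])
  obtain N where N: "t dvd N" "length l \<le> N" "\<forall>x\<in>?U. - int N \<le> x"
    by (rule exists_lower_bound_multiple[OF transversal_finite[OF U] t, where c = "length l"])
  have "2 * \<Sum>?U = - (int t * (int t + 1))"
    using card_runners(2)[OF t U bspec[OF N(3)] N(1)] card_maya_atLeast[OF l N(2)] by (simp add: maya)
  then show "?U \<in> {U. balanced_transversal t U}"
    using U by (simp add: balanced_transversal_def)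
next
  fix U assume "U \<in> {U. balanced_transversal t U}"
  then have U: "transversal t U" and sum: "2 * \<Sum>U = - (int t * (int t + 1))"
    by (auto simp: balanced_transversal_def)
  obtain N where N: "t dvd N" "0 \<le> N" "\<forall>x\<in>U. - int N \<le> x"
    by (rule exists_lower_bound_multiple[OF transversal_finite[OF U] t, where c = 0])
  have "2 * int t * int (card (runners t U \<inter> {- int N..})) = 2 * int t * int N"
    using card_runners(2)[OF t U bspec[OF N(3)] N(1)] sum by simp
  then have "card (runners t U \<inter> {- int N..}) = N" using t by simp
  then obtain l where l: "is_partition l" "maya l = runners t U"
    using exists_partition_of_maya[OF runners_lower[OF t U bspec[OF N(3)]]
        card_runners(1)[OF t U bspec[OF N(3)] N(1)]]
    by blast
  then have "is_core t l" using is_core_iff_closed[OF t] runners_closed by simp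
  then show "\<exists>l\<in>{l. is_core t l}. U = peaks t (maya l)"
    using l(2) peaks_runners[OF t U] by (intro bexI[of _ l]) auto
qed


subsection \<open>Codings\<close>

definition coding :: "nat \<Rightarrow> int list \<Rightarrow> real list" where
  "coding t u = map (\<lambda>x. of_int x + (real t + 1) / 2) u"

text \<open>The shift lies in \<open>Z_prime t\<close> for either parity, so shifted integers do
  too.\<close>

lemma center_eq_t_zero: "(real t + 1) / 2 = t_zero t + of_int (int ((t + 1) div 2))"
  by (cases "even t") (auto simp: t_zero_def elim!: evenE oddE)

lemma rmod_add_of_int_eq_iff:
  "(c + of_int x) rmod real t = (c + of_int y) rmod real t \<longleftrightarrow> x mod int t = y mod int t"
proof -
  have "(c + of_int x) rmod real t = (c + of_int y) rmod real t \<longleftrightarrow>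
      (\<exists>n. real_of_int y = of_int x + of_int n * real t)"
    unfolding rcong_def[symmetric] rcong_altdef by simp
  also have "\<dots> \<longleftrightarrow> (\<exists>n. y = x + int t * n)"
  proof -
    have "real_of_int y = of_int x + of_int n * real t \<longleftrightarrow> y = x + int t * n" for n
    proof -
      have "real_of_int x + of_int n * real t = of_int (x + int t * n)" by simp
      then show ?thesis by (metis of_int_eq_iff)
    qed
    then show ?thesis by simp
  qed
  also have "\<dots> \<longleftrightarrow> x mod int t = y mod int t"
    by (metis mod_eqE mod_mult_self2)
  finally show ?thesis .
qed

text \<open>Both families run through the same real classes modulo \<open>t\<close>; they differ by
  a rotation by the integer \<open>d\<close>.\<close>

lemma bij_betw_residues_rmod:
  fixes t :: nat
  assumes t: "t > 0"
  defines "c \<equiv> (real t + 1) / 2"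
  shows "bij_betw (\<lambda>r. (c + of_int r) rmod real t) {0..<int t}
    ((\<lambda>k. (t_zero t + real k) rmod real t) ` {0..<t})"
proof (rule bij_betw_imageI)
  show "inj_on (\<lambda>r. (c + of_int r) rmod real t) {0..<int t}"
    by (rule inj_onI) (simp add: rmod_add_of_int_eq_iff)
  define d where "d = int ((t + 1) div 2)"
  have c: "c = t_zero t + of_int d" by (simp add: c_def d_def center_eq_t_zero)
  have shift: "(c + of_int r) rmod real t = (t_zero t + of_int k) rmod real t"
    if "(r + d) mod int t = k mod int t" for r k
    using rmod_add_of_int_eq_iff[of "t_zero t" "d + r" t k] that
    by (simp add: c add.assoc add.commute[of r d])
  show "(\<lambda>r. (c + of_int r) rmod real t) ` {0..<int t} =
      (\<lambda>k. (t_zero t + real k) rmod real t) ` {0..<t}"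
  proof (intro equalityI subsetI)
    fix z assume "z \<in> (\<lambda>r. (c + of_int r) rmod real t) ` {0..<int t}"
    then obtain r where z: "z = (c + of_int r) rmod real t" by auto
    define k where "k = nat ((r + d) mod int t)"
    have k: "int k = (r + d) mod int t" "k < t" using t by (auto simp: k_def nat_less_iff)
    have "z = (t_zero t + real k) rmod real t"
      using shift[of r "int k"] k(1) z by (metis mod_mod_trivial of_int_of_nat_eq)
    then show "z \<in> (\<lambda>k. (t_zero t + real k) rmod real t) ` {0..<t}" using k(2) by auto
  next
    fix z assume "z \<in> (\<lambda>k. (t_zero t + real k) rmod real t) ` {0..<t}"
    then obtain k where z: "z = (t_zero t + real k) rmod real t" by auto
    have "z = (c + of_int ((int k - d) mod int t)) rmod real t"
      using shift[of "(int k - d) mod int t" "int k"] z by (simp add: mod_add_left_eq)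
    then show "z \<in> (\<lambda>r. (c + of_int r) rmod real t) ` {0..<int t}" using t by auto
  qed
qed

text \<open>The shift \<open>(t + 1) / 2\<close> turns the balance condition into sum zero, and
  congruence of shifted entries is congruence of integers.\<close>

lemma V_coding_coding_iff:
  assumes t: "t > 0"
  shows "V_coding t (coding t u) \<longleftrightarrow>
    length u = t \<and> sorted_wrt (>) u \<and> balanced_transversal t (set u)"
proof (cases "length u = t \<and> sorted_wrt (>) u")
  case True
  then have len: "length u = t" and desc: "sorted_wrt (>) u" by auto
  define c where "c = (real t + 1) / 2"
  have nth: "coding t u ! i = of_int (u ! i) + c" if "i < t" for i
    using that len by (simp add: coding_def c_def)
  have "distinct u"
    using desc by (auto simp: distinct_conv_nth sorted_wrt_iff_nth_less neq_iff)
  then have bij_u: "bij_betw ((!) u) {..<t} (set u)"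
    using len by (metis bij_betw_nth)
  let ?R = "(\<lambda>k. (t_zero t + real k) rmod real t) ` {0..<t}"
  let ?g = "\<lambda>r. (c + of_int r) rmod real t"
  have "bij_betw (\<lambda>i. (coding t u ! i) rmod real t) {..<t} ?R \<longleftrightarrow>
      bij_betw (?g \<circ> (!) u) {..<t} ?R"
    by (rule bij_betw_cong) (simp add: nth add.commute)
  also have "\<dots> \<longleftrightarrow> bij_betw ?g (set u) ?R"
    using bij_betw_comp_iff[OF bij_u] by blast
  \<comment> \<open>The map \<open>?g\<close> factors through the residue modulo \<open>t\<close>,
    on which it is already a bijection onto \<open>?R\<close>.\<close>
  also have "\<dots> \<longleftrightarrow> bij_betw (?g \<circ> (\<lambda>x. x mod int t)) (set u) ?R"
    by (rule bij_betw_cong) (simp add: rmod_add_of_int_eq_iff)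
  also have "\<dots> \<longleftrightarrow> transversal t (set u)"
    unfolding transversal_def
    by (rule bij_betw_comp_iff2[symmetric])
       (use bij_betw_residues_rmod[OF t] t in \<open>auto simp: c_def\<close>)
  finally have bij: "bij_betw (\<lambda>i. (coding t u ! i) rmod real t) {..<t} ?R \<longleftrightarrow>
      transversal t (set u)" .
  have "sum_list (coding t u) = of_int (\<Sum>(set u)) + real t * c"
  proof -
    have "sum_list (coding t u) = (\<Sum>x\<leftarrow>u. real_of_int x) + real (length u) * c"
      by (simp add: coding_def c_def sum_list_addf sum_list_triv)
    also have "(\<Sum>x\<leftarrow>u. real_of_int x) = of_int (\<Sum>(set u))"
      using \<open>distinct u\<close> by (simp add: sum_list_distinct_conv_sum_set)
    finally show ?thesis using len by simp
  qed
  also have "\<dots> = of_int (2 * \<Sum>(set u) + int t * (int t + 1)) / 2"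
    by (simp add: c_def field_simps)
  finally have sum: "sum_list (coding t u) = 0 \<longleftrightarrow> 2 * \<Sum>(set u) = - (int t * (int t + 1))"
    by (simp only: divide_eq_0_iff of_int_eq_0_iff) linarith
  have "set (coding t u) \<subseteq> Z_prime t"
  proof
    fix v assume "v \<in> set (coding t u)"
    then obtain x where "v = of_int x + c" by (auto simp: coding_def c_def)
    then have "v = t_zero t + of_int (int ((t + 1) div 2) + x)"
      unfolding c_def center_eq_t_zero by simp
    then show "v \<in> Z_prime t" unfolding Z_prime_def by blast
  qed
  moreover have "\<forall>i j. i < j \<longrightarrow> j < t \<longrightarrow> coding t u ! i > coding t u ! j"
    using desc len nth by (simp add: sorted_wrt_iff_nth_less)
  moreover have "length (coding t u) = t" using len by (simp add: coding_def)
  ultimately show ?thesis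
    unfolding V_coding_def balanced_transversal_def using True bij sum by blast
next
  case False
  have "length u = t" if "V_coding t (coding t u)"
    using that by (simp add: V_coding_def coding_def)
  moreover have "sorted_wrt (>) u" if "V_coding t (coding t u)" "length u = t"
    using that by (simp add: V_coding_def coding_def sorted_wrt_iff_nth_less)
  ultimately show ?thesis using False by blast
qed

lemma V_coding_imp_coding:
  assumes "V_coding t V"
  obtains u where "V = coding t u"
proof -
  let ?c = "(real t + 1) / 2"
  have "of_int \<lfloor>v - ?c\<rfloor> + ?c = v" if "v \<in> set V" for v
  proof -
    have "v \<in> Z_prime t" using assms that by (auto simp: V_coding_def)
    then obtain k :: int where "v = t_zero t + of_int k" by (auto simp: Z_prime_def)
    then have "v - ?c = of_int (k - int ((t + 1) div 2))"
      unfolding center_eq_t_zero by simp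
    then have "of_int \<lfloor>v - ?c\<rfloor> = v - ?c" by (metis floor_of_int)
    then show ?thesis by linarith
  qed
  then have "V = coding t (map (\<lambda>v. \<lfloor>v - ?c\<rfloor>) V)"
    by (simp add: coding_def map_idI)
  then show ?thesis using that by blast
qed

abbreviation desc_list :: "int set \<Rightarrow> int list" where
  "desc_list U \<equiv> rev (sorted_list_of_set U)"

lemma sorted_wrt_desc_list: "sorted_wrt (>) (desc_list U)"
  by (simp add: sorted_wrt_rev strict_sorted_list_of_set)

lemma bij_betw_V_coding:
  assumes t: "t > 0"
  shows "bij_betw (\<lambda>U. coding t (desc_list U)) {U. balanced_transversal t U} {V. V_coding t V}"
proof (rule bij_betwI')
  fix U W assume "U \<in> {U. balanced_transversal t U}" "W \<in> {U. balanced_transversal t U}"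
  then have fin: "finite U" "finite W"
    by (auto simp: balanced_transversal_def transversal_finite)
  have "inj (\<lambda>x. real_of_int x + (real t + 1) / 2)" by (rule injI) simp
  then have "coding t (desc_list U) = coding t (desc_list W) \<longleftrightarrow> desc_list U = desc_list W"
    unfolding coding_def using inj_map_eq_map by blast
  then show "coding t (desc_list U) = coding t (desc_list W) \<longleftrightarrow> U = W"
    using fin by (metis rev_rev_ident set_sorted_list_of_set)
next
  fix U assume "U \<in> {U. balanced_transversal t U}"
  then have U: "balanced_transversal t U" by simp
  then have "finite U" "card U = t"
    by (auto simp: balanced_transversal_def transversal_finite transversal_card)
  then show "coding t (desc_list U) \<in> {V. V_coding t V}"
    using U V_coding_coding_iff[OF t] sorted_wrt_desc_list by simp
next
  fix V assume "V \<in> {V. V_coding t V}"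
  then obtain u where V: "V = coding t u" "V_coding t (coding t u)"
    using V_coding_imp_coding by (metis mem_Collect_eq)
  then have u: "sorted_wrt (>) u" "balanced_transversal t (set u)"
    using V_coding_coding_iff[OF t] by auto
  \<comment> \<open>A strictly decreasing list is the only such enumeration of its set, so
    \<open>desc_list\<close> gives back \<open>u\<close>.\<close>
  have "sorted_wrt (<) (rev u)" using u(1) by (simp add: sorted_wrt_rev)
  then have "sorted_list_of_set (set u) = rev u"
    by (metis finite_set set_rev set_sorted_list_of_set strict_sorted_equal strict_sorted_list_of_set)
  then show "\<exists>U\<in>{U. balanced_transversal t U}. V = coding t (desc_list U)"
    using V u(2) by (intro bexI[of _ "set u"]) auto
qed

subsection \<open>Size and product formulas\<close>

text \<open>Lagrange's identity. For a coding the last square vanishes.\<close>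

lemma sum_pairs_diff_squared:
  fixes v :: "nat \<Rightarrow> real"
  shows "(\<Sum>(i, j)\<in>{(i, j). i < j \<and> j < n}. (v i - v j)\<^sup>2) =
    real n * (\<Sum>i<n. (v i)\<^sup>2) - (\<Sum>i<n. v i)\<^sup>2"
proof (induction n)
  case (Suc n)
  let ?A = "{(i, j). i < j \<and> j < n}"
  have split: "{(i, j). i < j \<and> j < Suc n} = ?A \<union> (\<lambda>i. (i, n)) ` {..<n}" by auto
  have "finite ?A"
    by (rule finite_subset[of _ "{..<n} \<times> {..<n}"]) auto
  then have "(\<Sum>(i, j)\<in>{(i, j). i < j \<and> j < Suc n}. (v i - v j)\<^sup>2) =
      (\<Sum>(i, j)\<in>?A. (v i - v j)\<^sup>2) + (\<Sum>(i, j)\<in>(\<lambda>i. (i, n)) ` {..<n}. (v i - v j)\<^sup>2)"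
    unfolding split by (intro sum.union_disjoint) auto
  also have "(\<Sum>(i, j)\<in>(\<lambda>i. (i, n)) ` {..<n}. (v i - v j)\<^sup>2) = (\<Sum>i<n. (v i - v n)\<^sup>2)"
    by (subst sum.reindex) (auto simp: inj_on_def)
  also have "\<dots> = (\<Sum>i<n. (v i)\<^sup>2) - 2 * v n * (\<Sum>i<n. v i) + real n * (v n)\<^sup>2"
    by (simp add: power2_diff sum.distrib sum_subtractf sum_distrib_left algebra_simps)
  finally show ?case
    unfolding Suc by (simp add: algebra_simps power2_eq_square)
qed simp

text \<open>Here \<open>t\<close> is independent of the bound \<open>m\<close>, so that the
  induction works; the use is \<open>m = t - 1\<close>.\<close>

lemma sum_weighted_squares:
  fixes t :: real
  shows "12 * (\<Sum>i=1..m. (t - real i) * (real i)\<^sup>2) =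
    2 * t * real m * (real m + 1) * (2 * real m + 1) - 3 * (real m * (real m + 1))\<^sup>2"
proof (induction m)
  case (Suc m)
  have "12 * (\<Sum>i=1..Suc m. (t - real i) * (real i)\<^sup>2) =
      12 * (\<Sum>i=1..m. (t - real i) * (real i)\<^sup>2) + 12 * ((t - real (Suc m)) * (real (Suc m))\<^sup>2)"
    by simp
  then show ?case
    unfolding Suc.IH by (simp add: algebra_simps power2_eq_square)
qed simp

lemma sum_mset_sum_replicate:
  fixes f :: "'b \<Rightarrow> real"
  shows "sum_mset (image_mset f (\<Sum>i\<in>A. replicate_mset (n i) (g i))) = (\<Sum>i\<in>A. real (n i) * f (g i))"
  by (induction A rule: infinite_finite_induct) auto

lemma prod_mset_sum_replicate:
  fixes f :: "'b \<Rightarrow> 'c :: comm_monoid_mult"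
  shows "prod_mset (image_mset f (\<Sum>i\<in>A. replicate_mset (n i) (g i))) = (\<Prod>i\<in>A. f (g i) ^ n i)"
  by (induction A rule: infinite_finite_induct) auto

text \<open>Squares are summed over \<open>core_hook_multiset\<close>. Each box contributes
  \<open>(h - t)^2 + (h + t)^2 - 2 * h^2 = 2 * t^2\<close>, the hook counts cancel, and what remains
  is the sum of \<open>(t - i) * i^2\<close>.\<close>

lemma core_size_formula:
  assumes t: "t > 0" and core: "is_core t l"
    and u: "sorted_wrt (>) u" "set u = peaks t (maya l)" "length u = t"
    and sum: "(\<Sum>i<t. coding t u ! i) = 0"
  shows "real (sum_list l) =
    1 / (2 * real t) * (\<Sum>i<t. (coding t u ! i)\<^sup>2) - (real t ^ 2 - 1) / 24"
proof -
  let ?sq = "\<lambda>k :: int. (real_of_int k)\<^sup>2"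
  let ?H = "hook_mset l"
  let ?P = "{(i, j). i < j \<and> j < t}"
  let ?v = "\<lambda>i. coding t u ! i"
  have P: "(\<Sum>(i, j)\<in>?P. ?sq (u ! i - u ! j)) = real t * (\<Sum>i<t. (?v i)\<^sup>2)"
  proof -
    have "(\<Sum>(i, j)\<in>?P. ?sq (u ! i - u ! j)) = (\<Sum>(i, j)\<in>?P. (?v i - ?v j)\<^sup>2)"
      using u(3) by (intro sum.cong) (auto simp: coding_def)
    then show ?thesis using sum by (simp add: sum_pairs_diff_squared)
  qed
  have "(\<Sum>h\<in>#?H. (real h - real t)\<^sup>2) + (\<Sum>h\<in>#?H. (real h + real t)\<^sup>2) +
      (\<Sum>i=1..t-1. real (hook_count l (t - i) + (t - i)) * (real i)\<^sup>2) =
    2 * (\<Sum>h\<in>#?H. (real h)\<^sup>2) + (\<Sum>i=1..t-1. real (hook_count l (t - i)) * (real i)\<^sup>2) +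
      (\<Sum>(i, j)\<in>?P. ?sq (u ! i - u ! j))"
    using arg_cong[OF core_hook_multiset[OF t core u], of "\<lambda>M. sum_mset (image_mset ?sq M)"]
    by (simp add: sum_mset_sum_replicate multiset.map_comp o_def sum_unfold_sum_mset[symmetric] case_prod_beta)
  moreover have "(\<Sum>h\<in>#M. (real h - real t)\<^sup>2) + (\<Sum>h\<in>#M. (real h + real t)\<^sup>2) =
      2 * (\<Sum>h\<in>#M. (real h)\<^sup>2) + 2 * (real t)\<^sup>2 * real (size M)" for M :: "nat multiset"
    by (induction M) (auto simp: power2_eq_square algebra_simps)
  moreover have "(\<Sum>i=1..t-1. real (hook_count l (t - i) + (t - i)) * (real i)\<^sup>2) =
      (\<Sum>i=1..t-1. real (hook_count l (t - i)) * (real i)\<^sup>2) +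
      (\<Sum>i=1..t-1. (real t - real i) * (real i)\<^sup>2)"
    unfolding sum.distrib[symmetric]
    by (intro sum.cong) (auto simp: of_nat_diff algebra_simps)
  moreover have "size ?H = sum_list l"
    by (simp add: hook_mset_def card_boxes)
  ultimately have "2 * (real t)\<^sup>2 * real (sum_list l) +
      (\<Sum>i=1..t-1. (real t - real i) * (real i)\<^sup>2) = real t * (\<Sum>i<t. (?v i)\<^sup>2)"
    using P by simp
  moreover have "12 * (\<Sum>i=1..t-1. (real t - real i) * (real i)\<^sup>2) =
      (real t)\<^sup>2 * ((real t)\<^sup>2 - 1)"
    using t unfolding sum_weighted_squares
    by (simp add: of_nat_diff algebra_simps power2_eq_square)
  ultimately have "24 * real t * real t * real (sum_list l) + real t * (real t * ((real t)\<^sup>2 - 1)) =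
      12 * real t * (\<Sum>i<t. (?v i)\<^sup>2)"
    by (simp add: algebra_simps power2_eq_square)
  then have "real t * (24 * real t * real (sum_list l) + real t * ((real t)\<^sup>2 - 1)) =
      real t * (12 * (\<Sum>i<t. (?v i)\<^sup>2))"
    by (simp add: algebra_simps)
  then have "24 * real t * real (sum_list l) + real t * ((real t)\<^sup>2 - 1) =
      12 * (\<Sum>i<t. (?v i)\<^sup>2)"
    using t by simp
  then show ?thesis using t by (simp add: field_simps)
qed

lemma prod_mset_mult_divide_square:
  fixes f g q :: "'b \<Rightarrow> 'a::field"
  shows "(\<Prod>h\<in>#M. f h * g h / (q h)\<^sup>2) = (\<Prod>h\<in>#M. f h) * (\<Prod>h\<in>#M. g h) / (\<Prod>h\<in>#M. q h)\<^sup>2"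
  by (induction M) (auto simp: power_mult_distrib)

text \<open>Applying \<tau> to both sides of \<open>core_hook_multiset\<close> and multiplying gives
  a division-free identity; the nonvanishing assumptions then permit dividing by \<open>C\<close>
  and \<open>Q^2\<close>.\<close>

lemma core_product_formula:
  fixes \<tau> :: "int \<Rightarrow> 'a::field"
  assumes t: "t > 0" and core: "is_core t l"
    and u: "sorted_wrt (>) u" "set u = peaks t (maya l)" "length u = t"
    and nz: "\<forall>h \<in># hook_mset l. \<tau> (int h) \<noteq> 0" "\<forall>i \<in> {1..t - 1}. \<tau> (int i) \<noteq> 0"
  shows "(\<Prod>h \<in># hook_mset l. \<tau> (int h - int t) * \<tau> (int h + int t) / (\<tau> (int h))^2) =
        (\<Prod>i = 1..t - 1.
           \<tau> (- int i) ^ hook_count l (t - i) / \<tau> (int i) ^ (hook_count l (t - i) + (t - i))) *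
        (\<Prod>(i, j) \<in> {(i, j). i < j \<and> j < t}. \<tau> \<lfloor>coding t u ! i - coding t u ! j\<rfloor>)"
proof -
  let ?H = "hook_mset l"
  define P where "P = (\<Prod>(i, j) \<in> {(i, j). i < j \<and> j < t}. \<tau> (u ! i - u ! j))"
  define C where "C = (\<Prod>i=1..t-1. \<tau> (int i) ^ (hook_count l (t - i) + (t - i)))"
  define E where "E = (\<Prod>i=1..t-1. \<tau> (- int i) ^ hook_count l (t - i))"
  define F where "F = (\<Prod>h\<in>#?H. \<tau> (int h - int t))"
  define G where "G = (\<Prod>h\<in>#?H. \<tau> (int h + int t))"
  define Q where "Q = (\<Prod>h\<in>#?H. \<tau> (int h))"
  have P: "(\<Prod>(i, j) \<in> {(i, j). i < j \<and> j < t}. \<tau> \<lfloor>coding t u ! i - coding t u ! j\<rfloor>) = P"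
    unfolding P_def
  proof (intro prod.cong refl)
    fix p assume "p \<in> {(i, j). i < j \<and> j < t}"
    then obtain i j where p: "p = (i, j)" "i < t" "j < t" by auto
    then have "coding t u ! i - coding t u ! j = of_int (u ! i - u ! j)"
      using u(3) by (simp add: coding_def)
    then show "(case p of (i, j) \<Rightarrow> \<tau> \<lfloor>coding t u ! i - coding t u ! j\<rfloor>) =
        (case p of (i, j) \<Rightarrow> \<tau> (u ! i - u ! j))"
      using p(1) by (simp only: prod.case floor_of_int)
  qed
  have FG: "F * G * C = Q * Q * E * P"
    using arg_cong[OF core_hook_multiset[OF t core u], of "\<lambda>M. prod_mset (image_mset \<tau> M)"]
    by (simp add: prod_mset_sum_replicate multiset.map_comp o_def prod_unfold_prod_mset[symmetric]
          case_prod_beta P_def C_def E_def Q_def F_def G_def)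
  have L: "(\<Prod>h\<in>#?H. \<tau> (int h - int t) * \<tau> (int h + int t) / (\<tau> (int h))\<^sup>2) =
      F * G / Q\<^sup>2"
    unfolding F_def G_def Q_def by (rule prod_mset_mult_divide_square)
  have "C \<noteq> 0" using nz(2) by (auto simp: C_def)
  have "Q \<noteq> 0" using nz(1) by (auto simp: Q_def prod_mset_zero_iff)
  then have "F * G / Q\<^sup>2 = E / C * P"
    using FG \<open>C \<noteq> 0\<close> by (simp add: field_simps power2_eq_square)
  with P show ?thesis
    unfolding L prod_dividef C_def[symmetric] E_def[symmetric] by simp
qed

theorem theorem1:
  fixes t :: nat and \<tau> :: "int \<Rightarrow> 'a::field"
  assumes "t > 0"
  shows "\<exists>\<phi> :: nat list \<Rightarrow> real list.
    bij_betw \<phi> {l. is_core t l} {V. V_coding t V} \<and>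
    (\<forall>l. is_core t l \<longrightarrow>
      real (sum_list l) =
        1 / (2 * real t) * (\<Sum>i<t. (\<phi> l ! i)^2) - (real t ^ 2 - 1) / 24 \<and>
      ((\<forall>h \<in># hook_mset l. \<tau> (int h) \<noteq> 0) \<and> (\<forall>i \<in> {1..t - 1}. \<tau> (int i) \<noteq> 0) \<longrightarrow>
        (\<Prod>h \<in># hook_mset l. \<tau> (int h - int t) * \<tau> (int h + int t) / (\<tau> (int h))^2) =
        (\<Prod>i = 1..t - 1.
           \<tau> (- int i) ^ hook_count l (t - i) / \<tau> (int i) ^ (hook_count l (t - i) + (t - i))) *
        (\<Prod>(i, j) \<in> {(i, j). i < j \<and> j < t}. \<tau> \<lfloor>\<phi> l ! i - \<phi> l ! j\<rfloor>)))"
proof -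
  \<comment> \<open>The bijection lists the peaks in decreasing order and shifts them; it is the
    same for every \<tau>.\<close>
  define u where "u l = desc_list (peaks t (maya l))" for l
  have bij: "bij_betw (\<lambda>l. coding t (u l)) {l. is_core t l} {V. V_coding t V}"
    using bij_betw_trans[OF bij_betw_core_peaks[OF assms] bij_betw_V_coding[OF assms]]
    by (simp add: o_def u_def)
  have u: "sorted_wrt (>) (u l)" "set (u l) = peaks t (maya l)" "length (u l) = t"
    and sum: "(\<Sum>i<t. coding t (u l) ! i) = 0" if "is_core t l" for l
  proof -
    show "sorted_wrt (>) (u l)" by (simp add: u_def sorted_wrt_desc_list)
    have "balanced_transversal t (peaks t (maya l))"
      using bij_betw_core_peaks[OF assms] that by (auto simp: bij_betw_def)
    then show "set (u l) = peaks t (maya l)" "length (u l) = t"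
      by (auto simp: u_def balanced_transversal_def transversal_finite transversal_card)
    have "V_coding t (coding t (u l))" using bij that by (auto simp: bij_betw_def)
    then show "(\<Sum>i<t. coding t (u l) ! i) = 0"
      by (auto simp: V_coding_def sum_list_sum_nth atLeast0LessThan)
  qed
  show ?thesis
    using bij core_size_formula[OF assms _ u sum] core_product_formula[OF assms _ u]
    by (intro exI[of _ "\<lambda>l. coding t (u l)"]) blast
qed

end
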